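(* The extreme points of $\mathrm{ball}(\mathrm{VMO})$ are precisely the functions $f\in\mathrm{VMO}$ with $\|f\|_G=1$.
   Context: $\mathbb D=\{z\in\mathbb C:|z|<1\}$, $\mathbb T=\partial\mathbb D$, $m$ is normalized arc length measure on $\mathbb T$, $L^p=L^p(\mathbb T,m)$ (complex-valued functions). For $f\in L^1$, the Poisson integral is $\mathcal Pf(z)=\int_{\mathbb T}f(\zeta)\frac{1-|z|^2}{|\zeta-z|^2}\,dm(\zeta)$, $z\in\mathbb D$. For $f\in L^2$ put $\Phi_f(z)=\mathcal P(|f|^2)(z)-|\mathcal Pf(z)|^2$, $z\in\mathbb D$, and $\|f\|_G=\sup_{z\in\mathbb D}\Phi_f(z)^{1/2}$ (the Garsia norm). $\mathrm{BMO}$ is the set of $f\in L^2$ with $\|f\|_G<\infty$, and $\mathrm{VMO}$ is the set of $f\in\mathrm{BMO}$ with $\Phi_f(z)\to0$ as $|z|\to1^-$. The functions annihilated by $\|\cdot\|_G$ are the constants, and $\mathrm{VMO}$ is regarded here as a quotient space modulo constants, normed by $\|\cdot\|_G$; thus an element $f$ of $\mathrm{VMO}$ is understood as the coset $f+\mathbb C$. For a normed space $X$, $\mathrm{ball}(X)=\{x\in X:\|x\|\le1\}$; an element $x\in\mathrm{ball}(X)$ is an extreme point of $\mathrm{ball}(X)$ if it is not of the form $x=\frac12(u+v)$ with two distinct points $u,v\in\mathrm{ball}(X)$. *)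

theory Defs
  imports "HOL-Complex_Analysis.Complex_Analysis"
begin

section \<open>Poisson integrals on the unit circle\<close>

text \<open>Normalized arc length on the unit circle, as the image of Lebesgue measure on the unit
  interval under \<open>t \<mapsto> exp (2 \<pi> i t)\<close>.\<close>

definition circle_measure :: "complex measure" where
  "circle_measure =
     distr (restrict_space lborel {0..1}) (restrict_space borel (sphere 0 1)) (\<lambda>t. cis (2 * pi * t))"

definition poisson_kernel :: "complex \<Rightarrow> complex \<Rightarrow> real" where
  "poisson_kernel z \<zeta> = (1 - (norm z)\<^sup>2) / (norm (\<zeta> - z))\<^sup>2"

definition poisson_integral ::
    "(complex \<Rightarrow> 'a::{banach, second_countable_topology}) \<Rightarrow> complex \<Rightarrow> 'a" where
  "poisson_integral f z = (LINT \<zeta>|circle_measure. poisson_kernel z \<zeta> *\<^sub>R f \<zeta>)"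

definition L2_circle :: "(complex \<Rightarrow> complex) set" where
  "L2_circle = {f \<in> borel_measurable circle_measure.
     integrable circle_measure (\<lambda>\<zeta>. (norm (f \<zeta>))\<^sup>2)}"


section \<open>The Garsia norm, BMO and VMO\<close>

definition Phi :: "(complex \<Rightarrow> complex) \<Rightarrow> complex \<Rightarrow> real" where
  "Phi f z = poisson_integral (\<lambda>\<zeta>. (norm (f \<zeta>))\<^sup>2) z - (norm (poisson_integral f z))\<^sup>2"

text \<open>The supremum is taken in the reals, so it is only meaningful for functions in \<open>BMO\<close>.\<close>

definition garsia_norm :: "(complex \<Rightarrow> complex) \<Rightarrow> real" where
  "garsia_norm f = (SUP z \<in> ball 0 1. sqrt (Phi f z))"

definition BMO :: "(complex \<Rightarrow> complex) set" where
  "BMO = {f \<in> L2_circle. bdd_above ((\<lambda>z. sqrt (Phi f z)) ` ball 0 1)}"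

text \<open>The filter \<open>filtercomap norm (at_left 1)\<close> expresses \<open>|z| \<rightarrow> 1-\<close>, uniformly in the
  argument of \<open>z\<close>.\<close>

definition VMO :: "(complex \<Rightarrow> complex) set" where
  "VMO = {f \<in> BMO. (Phi f \<longlongrightarrow> 0) (filtercomap norm (at_left 1))}"

text \<open>Two functions are identified if they differ by a constant almost everywhere.\<close>

definition vmo_eq :: "(complex \<Rightarrow> complex) \<Rightarrow> (complex \<Rightarrow> complex) \<Rightarrow> bool" where
  "vmo_eq f g \<longleftrightarrow> f \<in> VMO \<and> g \<in> VMO \<and> (\<exists>c. AE \<zeta> in circle_measure. f \<zeta> = g \<zeta> + c)"


section \<open>Basic properties\<close>

lemma cis_circle_measurable:
  "(\<lambda>t. cis (2 * pi * t)) \<in> restrict_space lborel {0..1} \<rightarrow>\<^sub>M restrict_space borel (sphere 0 1)"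
proof (rule measurable_restrict_space2)
  have "(\<lambda>t. cis (2 * pi * t)) \<in> borel_measurable borel"
    by (intro borel_measurable_continuous_onI continuous_intros)
  then show "(\<lambda>t. cis (2 * pi * t)) \<in> restrict_space lborel {0..1} \<rightarrow>\<^sub>M borel"
    by (intro measurable_restrict_space1) simp
qed auto

lemma space_circle_measure [simp]: "space circle_measure = sphere 0 1"
  by (simp add: circle_measure_def space_restrict_space)

lemma sets_circle_measure [measurable_cong]:
  "sets circle_measure = sets (restrict_space borel (sphere 0 1))"
  by (simp add: circle_measure_def)

interpretation circle: finite_measure circle_measure
proof (rule finite_measureI)
  have "emeasure circle_measure (space circle_measure)
      \<le> emeasure (restrict_space lborel {0..1::real}) (space (restrict_space lborel {0..1::real}))"
    unfolding circle_measure_def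
    by (subst emeasure_distr[OF cis_circle_measurable])
      (auto intro!: emeasure_mono sets.top simp: space_restrict_space sets_restrict_space_iff)
  also have "\<dots> = 1"
    by (simp add: space_restrict_space emeasure_restrict_space)
  finally show "emeasure circle_measure (space circle_measure) \<noteq> \<infinity>"
    by (auto simp: top_unique)
qed

lemma integral_circle_measure:
  fixes f :: "complex \<Rightarrow> 'a::{banach, second_countable_topology}"
  assumes [measurable]: "f \<in> borel_measurable circle_measure"
  shows "(LINT \<zeta>|circle_measure. f \<zeta>) = (LINT t:{0..1}|lborel. f (cis (2 * pi * t)))"
proof -
  have "f \<in> borel_measurable (restrict_space borel (sphere 0 1))"
    using assms by (simp add: measurable_def sets_circle_measure space_restrict_space)
  then have "(LINT \<zeta>|circle_measure. f \<zeta>)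
      = (LINT t|restrict_space lborel {0..1}. f (cis (2 * pi * t)))"
    unfolding circle_measure_def by (intro integral_distr cis_circle_measurable)
  also have "\<dots> = (LINT t:{0..1}|lborel. f (cis (2 * pi * t)))"
    by (subst integral_restrict_space) (auto simp: set_lebesgue_integral_def)
  finally show ?thesis .
qed

lemma continuous_on_circle_measurable:
  fixes f :: "complex \<Rightarrow> 'a::{banach, second_countable_topology}"
  assumes "continuous_on (sphere 0 1) f"
  shows "f \<in> borel_measurable circle_measure"
  using borel_measurable_continuous_on_restrict[OF assms]
  by (simp add: measurable_def sets_circle_measure space_restrict_space)

lemma continuous_on_circle_bounded:
  fixes f :: "complex \<Rightarrow> 'a::real_normed_vector"
  assumes "continuous_on (sphere 0 1) f"
  obtains B where "\<And>x. x \<in> sphere 0 1 \<Longrightarrow> norm (f x) \<le> B"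
proof -
  have "bounded (f ` sphere 0 1)"
    by (intro compact_imp_bounded compact_continuous_image assms) auto
  then show ?thesis
    using that unfolding bounded_iff by blast
qed

lemma integrable_bounded_circle:
  fixes f :: "complex \<Rightarrow> 'a::{banach, second_countable_topology}"
  assumes "continuous_on (sphere 0 1) f"
  shows "integrable circle_measure f"
proof -
  obtain B where B: "\<And>x. x \<in> sphere 0 1 \<Longrightarrow> norm (f x) \<le> B"
    using continuous_on_circle_bounded[OF assms] by blast
  show ?thesis
    by (rule circle.integrable_const_bound[of _ B])
      (use B continuous_on_circle_measurable[OF assms] in auto)
qed

lemma circle_mean_value:
  assumes "h holomorphic_on cball 0 1"
  shows "(LINT \<zeta>|circle_measure. h \<zeta>) = h 0"
proof -
  have cont: "continuous_on (sphere 0 1) h"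
    by (rule continuous_on_subset[OF holomorphic_on_imp_continuous_on[OF assms]]) auto
  have "((\<lambda>u. h u / (u - 0)) has_contour_integral (2 * of_real pi * \<i> * h 0)) (circlepath 0 1)"
    by (rule Cauchy_integral_circlepath_simple[OF assms]) auto
  then have "((\<lambda>t. h (circlepath 0 1 t) / circlepath 0 1 t *
      vector_derivative (circlepath 0 1) (at t)) has_integral (2 * of_real pi * \<i> * h 0)) {0..1}"
    by (simp add: has_contour_integral)
  then have "((\<lambda>t. 2 * of_real pi * \<i> * h (cis (2 * pi * t))) has_integral
      (2 * of_real pi * \<i> * h 0)) {0..1}"
    by (rule has_integral_eq[rotated])
      (simp only: vector_derivative_circlepath, simp add: circlepath cis_conv_exp mult_ac)
  then have "((\<lambda>t. inverse (2 * of_real pi * \<i>) * (2 * of_real pi * \<i> * h (cis (2 * pi * t)))) has_integral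
      (inverse (2 * of_real pi * \<i>) * (2 * of_real pi * \<i> * h 0))) {0..1}"
    by (rule has_integral_mult_right)
  then have *: "((\<lambda>t. h (cis (2 * pi * t))) has_integral h 0) {0..1}"
    by (simp add: field_simps)
  have "continuous_on {0..1} (\<lambda>t. h (cis (2 * pi * t)))"
    by (intro continuous_on_compose2[OF cont] continuous_intros) auto
  then have "set_integrable lborel {0..1} (\<lambda>t. h (cis (2 * pi * t)))"
    by (rule borel_integrable_atLeastAtMost')
  then show ?thesis
    using * continuous_on_circle_measurable[OF cont]
    by (simp add: integral_circle_measure set_borel_integral_eq_integral(2) integral_unique)
qed

lemma continuous_poisson_kernel:
  assumes "norm z < 1"
  shows "continuous_on (sphere 0 1) (poisson_kernel z)"
  unfolding poisson_kernel_def[abs_def] using assms by (intro continuous_intros) auto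

lemma poisson_kernel_nonneg: "norm z < 1 \<Longrightarrow> 0 \<le> poisson_kernel z \<zeta>"
  by (auto simp: poisson_kernel_def power_le_one)

lemma poisson_kernel_pos: "norm z < 1 \<Longrightarrow> norm \<zeta> = 1 \<Longrightarrow> 0 < poisson_kernel z \<zeta>"
  unfolding poisson_kernel_def
  by (intro divide_pos_pos) (auto simp: power_less_one_iff)

lemma poisson_kernel_eq_Re:
  assumes "norm z < 1" "norm \<zeta> = 1"
  shows "poisson_kernel z \<zeta> = Re ((1 + cnj z * \<zeta>) / (1 - cnj z * \<zeta>))"
proof -
  have \<zeta>: "\<zeta> * cnj \<zeta> = 1"
    using assms by (simp add: complex_norm_square[symmetric])
  have ne: "1 - cnj z * \<zeta> \<noteq> 0"
  proof
    assume "1 - cnj z * \<zeta> = 0"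
    then have "norm (cnj z * \<zeta>) = 1" by simp
    then show False using assms by (simp add: norm_mult)
  qed
  have "norm (\<zeta> - z) = norm (1 - cnj z * \<zeta>)"
  proof -
    have "\<zeta> - z = \<zeta> * cnj (1 - cnj z * \<zeta>)"
      using \<zeta> by (simp add: algebra_simps)
    then show ?thesis using assms by (simp add: norm_mult del: complex_cnj_diff)
  qed
  moreover have "Re ((1 + cnj z * \<zeta>) / (1 - cnj z * \<zeta>))
      = Re ((1 + cnj z * \<zeta>) * cnj (1 - cnj z * \<zeta>)) / (norm (1 - cnj z * \<zeta>))\<^sup>2"
    unfolding complex_div_cnj[of "1 + cnj z * \<zeta>"] by (simp only: Re_divide_of_real flip: of_real_power)
  moreover have "Re ((1 + w) * cnj (1 - w)) = 1 - (norm w)\<^sup>2" for w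
    unfolding cmod_power2 by (simp add: algebra_simps power2_eq_square)
  moreover have "norm (cnj z * \<zeta>) = norm z"
    using assms by (simp add: norm_mult)
  ultimately show ?thesis
    unfolding poisson_kernel_def by (simp only:)
qed

lemma integral_poisson_kernel:
  assumes "norm z < 1"
  shows "(LINT \<zeta>|circle_measure. poisson_kernel z \<zeta>) = 1"
proof -
  have ne: "1 - cnj z * \<zeta> \<noteq> 0" if "norm \<zeta> \<le> 1" for \<zeta>
  proof
    assume "1 - cnj z * \<zeta> = 0"
    then have "norm (cnj z * \<zeta>) = 1" by simp
    moreover have "norm (cnj z * \<zeta>) \<le> norm z"
      using that by (simp add: norm_mult mult_left_le)
    ultimately show False using assms by simp
  qed
  let ?h = "\<lambda>\<zeta>. (1 + cnj z * \<zeta>) / (1 - cnj z * \<zeta>)"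
  have hol: "?h holomorphic_on cball 0 1"
    by (intro holomorphic_intros) (use ne in auto)
  have int: "integrable circle_measure ?h"
    by (rule integrable_bounded_circle)
      (rule continuous_on_subset[OF holomorphic_on_imp_continuous_on[OF hol]], auto)
  have "(LINT \<zeta>|circle_measure. poisson_kernel z \<zeta>) = (LINT \<zeta>|circle_measure. Re (?h \<zeta>))"
    by (rule Bochner_Integration.integral_cong) (use assms poisson_kernel_eq_Re in auto)
  also have "\<dots> = Re (LINT \<zeta>|circle_measure. ?h \<zeta>)"
    by (rule integral_Re[OF int])
  also have "\<dots> = 1"
    using circle_mean_value[OF hol] by simp
  finally show ?thesis .
qed

lemma integrable_poisson:
  fixes f :: "complex \<Rightarrow> 'a::{banach, second_countable_topology}"
  assumes z: "norm z < 1" and f: "integrable circle_measure f"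
  shows "integrable circle_measure (\<lambda>\<zeta>. poisson_kernel z \<zeta> *\<^sub>R f \<zeta>)"
proof -
  have K: "continuous_on (sphere 0 1) (poisson_kernel z)"
    by (rule continuous_poisson_kernel[OF z])
  have [measurable]: "poisson_kernel z \<in> borel_measurable circle_measure"
    by (rule continuous_on_circle_measurable[OF K])
  have [measurable]: "f \<in> borel_measurable circle_measure"
    using f by auto
  obtain B where B: "\<And>x. x \<in> sphere 0 1 \<Longrightarrow> norm (poisson_kernel z x) \<le> B"
    using continuous_on_circle_bounded[OF K] by blast
  show ?thesis
  proof (rule Bochner_Integration.integrable_bound)
    show "integrable circle_measure (\<lambda>\<zeta>. B *\<^sub>R f \<zeta>)" using f by simp
    show "AE x in circle_measure. norm (poisson_kernel z x *\<^sub>R f x) \<le> norm (B *\<^sub>R f x)"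
    proof (rule AE_I2)
      fix x assume "x \<in> space circle_measure"
      then have "\<bar>poisson_kernel z x\<bar> \<le> \<bar>B\<bar>"
        using B[of x] by simp
      then show "norm (poisson_kernel z x *\<^sub>R f x) \<le> norm (B *\<^sub>R f x)"
        by (simp add: mult_right_mono)
    qed
  qed measurable
qed

lemma L2_circle_measurable: "f \<in> L2_circle \<Longrightarrow> f \<in> borel_measurable circle_measure"
  by (simp add: L2_circle_def)

lemma L2_circle_integrable_square:
  "f \<in> L2_circle \<Longrightarrow> integrable circle_measure (\<lambda>\<zeta>. (norm (f \<zeta>))\<^sup>2)"
  by (simp add: L2_circle_def)

lemma L2_circle_integrable:
  assumes f: "f \<in> L2_circle"
  shows "integrable circle_measure f"
proof (rule Bochner_Integration.integrable_bound)
  show "integrable circle_measure (\<lambda>\<zeta>. 1 + (norm (f \<zeta>))\<^sup>2)"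
    using L2_circle_integrable_square[OF f] by simp
  have "x \<le> 1 + x\<^sup>2" for x :: real
    using sum_power2_ge_zero[of "x - 1" x] by (simp add: power2_eq_square algebra_simps) 
  then show "AE x in circle_measure. norm (f x) \<le> norm (1 + (norm (f x))\<^sup>2)"
    by (intro AE_I2) auto
qed (rule L2_circle_measurable[OF f])

lemma L2_circle_const [simp]: "(\<lambda>_. c) \<in> L2_circle"
  by (simp add: L2_circle_def)

lemma norm_add_square_le:
  fixes u v :: "'a::real_inner" and t :: real
  assumes "t > 0"
  shows "(norm (u + v))\<^sup>2 \<le> (1 + t) * (norm u)\<^sup>2 + (1 + 1 / t) * (norm v)\<^sup>2"
proof -
  have "0 \<le> (norm (sqrt t *\<^sub>R u - (1 / sqrt t) *\<^sub>R v))\<^sup>2" by simp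
  also have "\<dots> = t * (norm u)\<^sup>2 + (1 / t) * (norm v)\<^sup>2 - 2 * (u \<bullet> v)"
    using assms unfolding power2_norm_eq_inner
    by (simp add: inner_diff_left inner_diff_right inner_commute algebra_simps
        flip: power2_eq_square)
  finally show ?thesis
    unfolding power2_norm_eq_inner by (simp add: algebra_simps inner_commute)
qed

lemma L2_circle_add:
  assumes f: "f \<in> L2_circle" and g: "g \<in> L2_circle"
  shows "(\<lambda>\<zeta>. f \<zeta> + g \<zeta>) \<in> L2_circle"
proof -
  note [measurable] = L2_circle_measurable[OF f] L2_circle_measurable[OF g]
  have "integrable circle_measure (\<lambda>\<zeta>. (norm (f \<zeta> + g \<zeta>))\<^sup>2)"
  proof (rule Bochner_Integration.integrable_bound)
    show "integrable circle_measure (\<lambda>\<zeta>. 2 * (norm (f \<zeta>))\<^sup>2 + 2 * (norm (g \<zeta>))\<^sup>2)"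
      using L2_circle_integrable_square[OF f] L2_circle_integrable_square[OF g] by simp
    show "AE x in circle_measure. norm ((norm (f x + g x))\<^sup>2)
        \<le> norm (2 * (norm (f x))\<^sup>2 + 2 * (norm (g x))\<^sup>2)"
      using norm_add_square_le[of 1 "f _" "g _"] by (intro AE_I2) auto
  qed measurable
  then show ?thesis by (simp add: L2_circle_def)
qed

lemma L2_circle_scale:
  assumes f: "f \<in> L2_circle"
  shows "(\<lambda>\<zeta>. c * f \<zeta>) \<in> L2_circle"
  using assms by (auto simp: L2_circle_def norm_mult power_mult_distrib)

lemma poisson_integral_const:
  assumes "norm z < 1"
  shows "poisson_integral (\<lambda>_. c) z = c"
  using integral_poisson_kernel[OF assms] integrable_bounded_circle[OF continuous_poisson_kernel[OF assms]]
  by (simp add: poisson_integral_def)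

lemma poisson_integral_add:
  assumes "norm z < 1" "integrable circle_measure f" "integrable circle_measure g"
  shows "poisson_integral (\<lambda>\<zeta>. f \<zeta> + g \<zeta>) z = poisson_integral f z + poisson_integral g z"
  using assms by (simp add: poisson_integral_def scaleR_add_right integrable_poisson)

lemma poisson_integral_scaleR:
  assumes "norm z < 1" "integrable circle_measure f"
  shows "poisson_integral (\<lambda>\<zeta>. a *\<^sub>R f \<zeta>) z = a *\<^sub>R poisson_integral f z"
  unfolding poisson_integral_def scaleR_left_commute[of _ a] by (rule integral_scaleR_right)

lemma poisson_integral_mult:
  fixes f :: "complex \<Rightarrow> complex"
  shows "poisson_integral (\<lambda>\<zeta>. c * f \<zeta>) z = c * poisson_integral f z"
  by (simp add: poisson_integral_def mult_scaleR_right[symmetric] del: mult_scaleR_right)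

lemma poisson_integral_mono:
  fixes f g :: "complex \<Rightarrow> real"
  assumes "norm z < 1" "integrable circle_measure f" "integrable circle_measure g"
    and "\<And>\<zeta>. norm \<zeta> = 1 \<Longrightarrow> f \<zeta> \<le> g \<zeta>"
  shows "poisson_integral f z \<le> poisson_integral g z"
  unfolding poisson_integral_def
  by (rule integral_mono[OF integrable_poisson integrable_poisson])
    (use assms poisson_kernel_nonneg[of z] in \<open>auto intro!: mult_left_mono\<close>)

lemma poisson_integral_square_shift:
  assumes z: "norm z < 1" and f: "f \<in> L2_circle"
  shows "poisson_integral (\<lambda>\<zeta>. (norm (f \<zeta> - a))\<^sup>2) z
    = Phi f z + (norm (poisson_integral f z - a))\<^sup>2"
proof -
  note i1 = L2_circle_integrable_square[OF f] and i2 = L2_circle_integrable[OF f]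
  have i3: "integrable circle_measure (\<lambda>\<zeta>. f \<zeta> \<bullet> a)" using i2 by simp
  have i4: "integrable circle_measure (\<lambda>\<zeta>. (-2) *\<^sub>R (f \<zeta> \<bullet> a))" using i3 by simp
  have *: "poisson_integral (\<lambda>\<zeta>. f \<zeta> \<bullet> a) z = poisson_integral f z \<bullet> a"
    unfolding poisson_integral_def inner_scaleR_left[symmetric] real_scaleR_def
    by (rule integral_inner_left) (use integrable_poisson[OF z i2] in simp)
  have "(\<lambda>\<zeta>. (norm (f \<zeta> - a))\<^sup>2) = (\<lambda>\<zeta>. ((norm (f \<zeta>))\<^sup>2 + (-2) *\<^sub>R (f \<zeta> \<bullet> a)) + (norm a)\<^sup>2)"
    by (auto simp: power2_norm_eq_inner inner_diff_left inner_diff_right inner_commute)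
  then have "poisson_integral (\<lambda>\<zeta>. (norm (f \<zeta> - a))\<^sup>2) z
      = poisson_integral (\<lambda>\<zeta>. (norm (f \<zeta>))\<^sup>2) z + (-2) *\<^sub>R (poisson_integral f z \<bullet> a) + (norm a)\<^sup>2"
    using i1 i3 i4
    by (simp only: poisson_integral_add[OF z] poisson_integral_scaleR[OF z]
        poisson_integral_const[OF z] * Bochner_Integration.integrable_add circle.integrable_const)
  then show ?thesis
    by (simp add: Phi_def power2_norm_eq_inner inner_diff_left inner_diff_right inner_commute)
qed

lemma Phi_eq_variance:
  assumes "norm z < 1" "f \<in> L2_circle"
  shows "Phi f z = poisson_integral (\<lambda>\<zeta>. (norm (f \<zeta> - poisson_integral f z))\<^sup>2) z"
  using poisson_integral_square_shift[OF assms, of "poisson_integral f z"] by simp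

lemma Phi_nonneg:
  assumes "norm z < 1" "f \<in> L2_circle"
  shows "0 \<le> Phi f z"
  unfolding Phi_eq_variance[OF assms] unfolding poisson_integral_def
  by (rule integral_nonneg_AE) (use assms poisson_kernel_nonneg in auto)

lemma integrable_shift_square:
  "f \<in> L2_circle \<Longrightarrow> integrable circle_measure (\<lambda>\<zeta>. (norm (f \<zeta> - a))\<^sup>2)"
  using L2_circle_add[of f "\<lambda>_. - a"] by (simp add: L2_circle_def)

lemma Phi_add_le:
  assumes z: "norm z < 1" and f: "f \<in> L2_circle" and g: "g \<in> L2_circle" and t: "t > 0"
  shows "Phi (\<lambda>\<zeta>. f \<zeta> + g \<zeta>) z \<le> (1 + t) * Phi f z + (1 + 1 / t) * Phi g z"
proof -
  define a b where "a = poisson_integral f z" and "b = poisson_integral g z"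
  have fg: "(\<lambda>\<zeta>. f \<zeta> + g \<zeta>) \<in> L2_circle" by (rule L2_circle_add[OF f g])
  have ab: "poisson_integral (\<lambda>\<zeta>. f \<zeta> + g \<zeta>) z = a + b"
    using poisson_integral_add[OF z L2_circle_integrable[OF f] L2_circle_integrable[OF g]]
    by (simp add: a_def b_def)
  have "Phi (\<lambda>\<zeta>. f \<zeta> + g \<zeta>) z = poisson_integral (\<lambda>\<zeta>. (norm (f \<zeta> + g \<zeta> - (a + b)))\<^sup>2) z"
    using Phi_eq_variance[OF z fg] ab by simp
  also have "\<dots> \<le> poisson_integral (\<lambda>\<zeta>. (1 + t) *\<^sub>R (norm (f \<zeta> - a))\<^sup>2
      + (1 + 1 / t) *\<^sub>R (norm (g \<zeta> - b))\<^sup>2) z"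
  proof (rule poisson_integral_mono[OF z integrable_shift_square[OF fg]])
    show "(norm (f \<zeta> + g \<zeta> - (a + b)))\<^sup>2
        \<le> (1 + t) *\<^sub>R (norm (f \<zeta> - a))\<^sup>2 + (1 + 1 / t) *\<^sub>R (norm (g \<zeta> - b))\<^sup>2" for \<zeta>
      using norm_add_square_le[OF t, of "f \<zeta> - a" "g \<zeta> - b"] by (simp add: algebra_simps)
  qed (intro Bochner_Integration.integrable_add integrable_scaleR_right integrable_shift_square f g)
  also have "\<dots> = (1 + t) *\<^sub>R poisson_integral (\<lambda>\<zeta>. (norm (f \<zeta> - a))\<^sup>2) z
      + (1 + 1 / t) *\<^sub>R poisson_integral (\<lambda>\<zeta>. (norm (g \<zeta> - b))\<^sup>2) z"
    using integrable_shift_square[OF f] integrable_shift_square[OF g]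
    by (simp only: poisson_integral_add[OF z] poisson_integral_scaleR[OF z]
        integrable_scaleR_right)
  also have "\<dots> = (1 + t) * Phi f z + (1 + 1 / t) * Phi g z"
    using Phi_eq_variance[OF z f] Phi_eq_variance[OF z g] by (simp add: a_def b_def)
  finally show ?thesis .
qed

lemma sqrt_le_add_sqrtI:
  fixes A B C :: real
  assumes "0 \<le> A" "0 \<le> B" and le: "\<And>t. t > 0 \<Longrightarrow> C \<le> (1 + t) * A + (1 + 1 / t) * B"
  shows "sqrt C \<le> sqrt A + sqrt B"
proof (rule field_le_epsilon)
  fix e :: real assume e: "e > 0"
  define a b where "a = sqrt A + e / 2" and "b = sqrt B + e / 2"
  have pos: "a > 0" "b > 0"
    using assms e by (auto simp: a_def b_def add_nonneg_pos)
  have "A = (sqrt A)\<^sup>2" "B = (sqrt B)\<^sup>2" using assms by auto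
  moreover have "(sqrt A)\<^sup>2 \<le> a\<^sup>2" "(sqrt B)\<^sup>2 \<le> b\<^sup>2"
    using assms(1,2) e unfolding a_def b_def by (intro power_mono; simp)+
  ultimately have AB: "A \<le> a\<^sup>2" "B \<le> b\<^sup>2" by auto
  have "C \<le> (1 + b / a) * A + (1 + 1 / (b / a)) * B"
    using pos by (intro le) auto
  also have "\<dots> \<le> (1 + b / a) * a\<^sup>2 + (1 + 1 / (b / a)) * b\<^sup>2"
    using pos AB by (intro add_mono mult_left_mono) auto
  also have "\<dots> = (a + b)\<^sup>2"
    using pos by (simp add: field_simps power2_eq_square)
  finally have "sqrt C \<le> sqrt ((a + b)\<^sup>2)" by (rule real_sqrt_le_mono)
  then show "sqrt C \<le> sqrt A + sqrt B + e"
    using pos by (simp add: a_def b_def)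
qed

lemma sqrt_Phi_add_le:
  assumes "norm z < 1" "f \<in> L2_circle" "g \<in> L2_circle"
  shows "sqrt (Phi (\<lambda>\<zeta>. f \<zeta> + g \<zeta>) z) \<le> sqrt (Phi f z) + sqrt (Phi g z)"
  using assms by (intro sqrt_le_add_sqrtI Phi_nonneg Phi_add_le)

lemma Phi_scale: "Phi (\<lambda>\<zeta>. c * f \<zeta>) z = (norm c)\<^sup>2 * Phi f z"
proof -
  have "poisson_integral (\<lambda>\<zeta>. (norm (c * f \<zeta>))\<^sup>2) z
      = (norm c)\<^sup>2 * poisson_integral (\<lambda>\<zeta>. (norm (f \<zeta>))\<^sup>2) z"
    by (simp add: poisson_integral_def norm_mult power_mult_distrib mult.left_commute[of _ "(norm c)\<^sup>2"])
  then show ?thesis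
    by (simp add: Phi_def poisson_integral_mult norm_mult power_mult_distrib algebra_simps)
qed

lemma Phi_const: "norm z < 1 \<Longrightarrow> Phi (\<lambda>_. c) z = 0"
  by (simp add: Phi_def poisson_integral_const)

lemma Phi_AE_cong:
  assumes f: "f \<in> L2_circle" and g: "g \<in> L2_circle" and z: "norm z < 1"
    and ae: "AE \<zeta> in circle_measure. f \<zeta> = g \<zeta> + c"
  shows "Phi f z = Phi g z"
proof -
  note [measurable] = L2_circle_measurable[OF f] L2_circle_measurable[OF g]
    continuous_on_circle_measurable[OF continuous_poisson_kernel[OF z]]
  have "poisson_integral f z = poisson_integral (\<lambda>\<zeta>. g \<zeta> + c) z"
    unfolding poisson_integral_def by (rule integral_cong_AE) (use ae in auto)
  then have Pf: "poisson_integral f z = poisson_integral g z + c"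
    using poisson_integral_add[OF z L2_circle_integrable[OF g], of "\<lambda>_. c"]
    by (simp add: poisson_integral_const[OF z])
  have "Phi f z = poisson_integral (\<lambda>\<zeta>. (norm (f \<zeta> - poisson_integral f z))\<^sup>2) z"
    by (rule Phi_eq_variance[OF z f])
  also have "\<dots> = poisson_integral (\<lambda>\<zeta>. (norm (g \<zeta> - poisson_integral g z))\<^sup>2) z"
    unfolding poisson_integral_def[of "\<lambda>\<zeta>. (norm (_ \<zeta> - _))\<^sup>2"]
    by (rule integral_cong_AE) (use ae Pf in auto)
  also have "\<dots> = Phi g z"
    by (rule Phi_eq_variance[OF z g, symmetric])
  finally show ?thesis .
qed

lemma Phi_eq_0_imp_AE_const:
  assumes z: "norm z < 1" and f: "f \<in> L2_circle" and "Phi f z = 0"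
  shows "AE \<zeta> in circle_measure. f \<zeta> = poisson_integral f z"
proof -
  let ?g = "\<lambda>\<zeta>. poisson_kernel z \<zeta> *\<^sub>R (norm (f \<zeta> - poisson_integral f z))\<^sup>2"
  have "integral\<^sup>L circle_measure ?g = 0"
    using assms Phi_eq_variance[OF z f] by (simp add: poisson_integral_def)
  moreover have "integrable circle_measure ?g"
    by (intro integrable_poisson z integrable_shift_square f)
  moreover have "AE \<zeta> in circle_measure. 0 \<le> ?g \<zeta>"
    using poisson_kernel_nonneg[OF z] by auto
  ultimately have "AE \<zeta> in circle_measure. ?g \<zeta> = 0"
    by (simp add: integral_nonneg_eq_0_iff_AE)
  then show ?thesis
  proof (rule AE_mp, intro AE_I2 impI)
    fix \<zeta> assume "\<zeta> \<in> space circle_measure" "?g \<zeta> = 0"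
    then show "f \<zeta> = poisson_integral f z"
      using poisson_kernel_pos[OF z, of \<zeta>] by auto
  qed
qed

lemma garsia_norm_upper:
  "f \<in> BMO \<Longrightarrow> norm z < 1 \<Longrightarrow> sqrt (Phi f z) \<le> garsia_norm f"
  unfolding garsia_norm_def by (rule cSUP_upper) (auto simp: BMO_def)

lemma BMO_imp_L2: "f \<in> BMO \<Longrightarrow> f \<in> L2_circle"
  by (simp add: BMO_def)

lemma VMO_imp_BMO: "f \<in> VMO \<Longrightarrow> f \<in> BMO"
  by (simp add: VMO_def)

lemma VMO_imp_L2: "f \<in> VMO \<Longrightarrow> f \<in> L2_circle"
  by (simp add: VMO_def BMO_def)

lemma garsia_norm_nonneg: "f \<in> BMO \<Longrightarrow> 0 \<le> garsia_norm f"
  using garsia_norm_upper[of f 0] Phi_nonneg[of 0 f] BMO_imp_L2[of f]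
  by (auto intro: order_trans[of _ "sqrt (Phi f 0)"])

lemma BMO_add:
  assumes f: "f \<in> BMO" and g: "g \<in> BMO"
  shows "(\<lambda>\<zeta>. f \<zeta> + g \<zeta>) \<in> BMO"
proof -
  have "sqrt (Phi (\<lambda>\<zeta>. f \<zeta> + g \<zeta>) z) \<le> garsia_norm f + garsia_norm g" if "norm z < 1" for z
    using sqrt_Phi_add_le[OF that BMO_imp_L2[OF f] BMO_imp_L2[OF g]]
      garsia_norm_upper[OF f that] garsia_norm_upper[OF g that] by linarith
  then show ?thesis
    using L2_circle_add[OF BMO_imp_L2[OF f] BMO_imp_L2[OF g]]
    by (auto simp: BMO_def intro!: bdd_aboveI2)
qed

lemma garsia_norm_triangle:
  assumes f: "f \<in> BMO" and g: "g \<in> BMO"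
  shows "garsia_norm (\<lambda>\<zeta>. f \<zeta> + g \<zeta>) \<le> garsia_norm f + garsia_norm g"
proof -
  have "sqrt (Phi (\<lambda>\<zeta>. f \<zeta> + g \<zeta>) z) \<le> garsia_norm f + garsia_norm g" if "norm z < 1" for z
    using sqrt_Phi_add_le[OF that BMO_imp_L2[OF f] BMO_imp_L2[OF g]]
      garsia_norm_upper[OF f that] garsia_norm_upper[OF g that] by linarith
  then show ?thesis
    unfolding garsia_norm_def[of "\<lambda>\<zeta>. f \<zeta> + g \<zeta>"] by (intro cSUP_least) auto
qed

lemma sqrt_Phi_scale: "sqrt (Phi (\<lambda>\<zeta>. c * f \<zeta>) z) = norm c * sqrt (Phi f z)"
  by (simp add: Phi_scale real_sqrt_mult)

lemma BMO_scale:
  assumes f: "f \<in> BMO"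
  shows "(\<lambda>\<zeta>. c * f \<zeta>) \<in> BMO"
proof -
  have "sqrt (Phi (\<lambda>\<zeta>. c * f \<zeta>) z) \<le> norm c * garsia_norm f" if "norm z < 1" for z
    using garsia_norm_upper[OF f that] by (simp add: sqrt_Phi_scale mult_left_mono)
  then show ?thesis
    using L2_circle_scale[OF BMO_imp_L2[OF f]]
    by (auto simp: BMO_def intro!: bdd_aboveI2)
qed

lemma garsia_norm_scale:
  assumes f: "f \<in> BMO"
  shows "garsia_norm (\<lambda>\<zeta>. c * f \<zeta>) = norm c * garsia_norm f"
proof -
  have le: "garsia_norm (\<lambda>\<zeta>. c * f \<zeta>) \<le> norm c * garsia_norm f" if f: "f \<in> BMO" for c f
    unfolding garsia_norm_def[of "\<lambda>\<zeta>. c * f \<zeta>"]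
    by (rule cSUP_least) (use garsia_norm_upper[OF f] in \<open>auto simp: sqrt_Phi_scale mult_left_mono\<close>)
  show ?thesis
  proof (cases "c = 0")
    case True
    then show ?thesis
      using le[OF f, of 0] garsia_norm_nonneg[OF BMO_scale[OF f, of 0]] by auto
  next
    case False
    then have "garsia_norm f \<le> norm (inverse c) * garsia_norm (\<lambda>\<zeta>. c * f \<zeta>)"
      using le[OF BMO_scale[OF f, of c], of "inverse c"] by (simp add: field_simps)
    then have "norm c * garsia_norm f \<le> garsia_norm (\<lambda>\<zeta>. c * f \<zeta>)"
      using False by (simp add: norm_divide field_simps)
    then show ?thesis using le[OF f, of c] by simp
  qed
qed

lemma eventually_in_disc:
  "eventually (\<lambda>z::complex. norm z < 1) (filtercomap norm (at_left 1))"
  by (rule eventually_filtercomapI) (simp add: eventually_at_filter)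

lemma VMO_add:
  assumes f: "f \<in> VMO" and g: "g \<in> VMO"
  shows "(\<lambda>\<zeta>. f \<zeta> + g \<zeta>) \<in> VMO"
proof -
  let ?F = "filtercomap norm (at_left (1::real)) :: complex filter"
  have lim: "((\<lambda>z. (1 + 1) * Phi f z + (1 + 1 / 1) * Phi g z) \<longlongrightarrow> (1 + 1) * 0 + (1 + 1 / 1) * 0) ?F"
    using f g by (intro tendsto_intros) (auto simp: VMO_def)
  have "(Phi (\<lambda>\<zeta>. f \<zeta> + g \<zeta>) \<longlongrightarrow> 0) ?F"
  proof (rule tendsto_sandwich[OF _ _ tendsto_const])
    show "eventually (\<lambda>z. 0 \<le> Phi (\<lambda>\<zeta>. f \<zeta> + g \<zeta>) z) ?F"
      using eventually_in_disc
      by eventually_elim (intro Phi_nonneg L2_circle_add VMO_imp_L2 f g)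
    show "eventually (\<lambda>z. Phi (\<lambda>\<zeta>. f \<zeta> + g \<zeta>) z \<le> (1 + 1) * Phi f z + (1 + 1 / 1) * Phi g z) ?F"
      using eventually_in_disc
      by eventually_elim (intro Phi_add_le VMO_imp_L2 f g zero_less_one)
    show "((\<lambda>z. (1 + 1) * Phi f z + (1 + 1 / 1) * Phi g z) \<longlongrightarrow> 0) ?F"
      using lim by simp
  qed
  then show ?thesis
    using BMO_add[OF VMO_imp_BMO[OF f] VMO_imp_BMO[OF g]] by (simp add: VMO_def)
qed

lemma VMO_scale:
  assumes f: "f \<in> VMO"
  shows "(\<lambda>\<zeta>. c * f \<zeta>) \<in> VMO"
proof -
  have "((\<lambda>z. (norm c)\<^sup>2 * Phi f z) \<longlongrightarrow> (norm c)\<^sup>2 * 0) (filtercomap norm (at_left 1))"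
    using f by (intro tendsto_intros) (auto simp: VMO_def)
  then show ?thesis
    using BMO_scale[OF VMO_imp_BMO[OF f]] by (simp add: VMO_def Phi_scale[abs_def])
qed

lemma VMO_const: "(\<lambda>_. c) \<in> VMO"
proof -
  have "(Phi (\<lambda>_. c) \<longlongrightarrow> 0) (filtercomap norm (at_left 1))"
    by (rule tendsto_eventually, rule eventually_mono[OF eventually_in_disc]) (simp add: Phi_const)
  then show ?thesis
    by (auto simp: VMO_def BMO_def Phi_const intro!: bdd_aboveI2[of _ _ 0])
qed

lemma garsia_norm_cong:
  assumes "vmo_eq f g"
  shows "garsia_norm f = garsia_norm g"
  unfolding garsia_norm_def
  by (rule SUP_cong) (use assms Phi_AE_cong VMO_imp_L2 in \<open>auto simp: vmo_eq_def\<close>)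

lemma garsia_norm_eq_0_iff:
  assumes f: "f \<in> VMO"
  shows "garsia_norm f = 0 \<longleftrightarrow> vmo_eq f (\<lambda>_. 0)"
proof
  assume "garsia_norm f = 0"
  then have "Phi f 0 = 0"
    using garsia_norm_upper[OF VMO_imp_BMO[OF f], of 0] Phi_nonneg[OF _ VMO_imp_L2[OF f], of 0]
    by (metis norm_zero zero_less_one real_sqrt_le_0_iff antisym)
  from Phi_eq_0_imp_AE_const[OF _ VMO_imp_L2[OF f] this]
  show "vmo_eq f (\<lambda>_. 0)"
    using f VMO_const by (auto simp: vmo_eq_def)
next
  assume "vmo_eq f (\<lambda>_. 0)"
  from garsia_norm_cong[OF this] show "garsia_norm f = 0"
    using garsia_norm_scale[OF VMO_imp_BMO[OF VMO_const], of 0 0] by simp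
qed

lemma part_equivp_vmo_eq: "part_equivp vmo_eq"
proof (rule part_equivpI)
  show "\<exists>f. vmo_eq f f"
    using VMO_const[of 0] by (auto simp: vmo_eq_def intro!: exI[of _ "\<lambda>_. 0"] exI[of _ 0])
  show "symp vmo_eq"
  proof (rule sympI)
    fix f g assume "vmo_eq f g"
    then obtain c where "f \<in> VMO" "g \<in> VMO" "AE \<zeta> in circle_measure. f \<zeta> = g \<zeta> + c"
      by (auto simp: vmo_eq_def)
    moreover from this(3) have "AE \<zeta> in circle_measure. g \<zeta> = f \<zeta> + - c"
      by eventually_elim simp
    ultimately show "vmo_eq g f" unfolding vmo_eq_def by blast
  qed
  show "transp vmo_eq"
  proof (rule transpI)
    fix f g h assume "vmo_eq f g" "vmo_eq g h"
    then obtain c d where "f \<in> VMO" "h \<in> VMO"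
      and c: "AE \<zeta> in circle_measure. f \<zeta> = g \<zeta> + c"
      and d: "AE \<zeta> in circle_measure. g \<zeta> = h \<zeta> + d"
      by (auto simp: vmo_eq_def)
    moreover from c d have "AE \<zeta> in circle_measure. f \<zeta> = h \<zeta> + (d + c)"
      by eventually_elim simp
    ultimately show "vmo_eq f h" unfolding vmo_eq_def by blast
  qed
qed

lemma vmo_eq_add:
  assumes "vmo_eq f f'" "vmo_eq g g'"
  shows "vmo_eq (\<lambda>\<zeta>. f \<zeta> + g \<zeta>) (\<lambda>\<zeta>. f' \<zeta> + g' \<zeta>)"
proof -
  from assms obtain c d where
    c: "AE \<zeta> in circle_measure. f \<zeta> = f' \<zeta> + c" and d: "AE \<zeta> in circle_measure. g \<zeta> = g' \<zeta> + d"
    by (auto simp: vmo_eq_def)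
  from c d have "AE \<zeta> in circle_measure. f \<zeta> + g \<zeta> = (f' \<zeta> + g' \<zeta>) + (c + d)"
    by eventually_elim simp
  then show ?thesis
    using assms VMO_add unfolding vmo_eq_def by blast
qed

lemma vmo_eq_scale:
  assumes "vmo_eq f f'"
  shows "vmo_eq (\<lambda>\<zeta>. a * f \<zeta>) (\<lambda>\<zeta>. a * f' \<zeta>)"
proof -
  from assms obtain c where c: "AE \<zeta> in circle_measure. f \<zeta> = f' \<zeta> + c"
    by (auto simp: vmo_eq_def)
  from c have "AE \<zeta> in circle_measure. a * f \<zeta> = a * f' \<zeta> + a * c"
    by eventually_elim (simp add: algebra_simps)
  then show ?thesis
    using assms VMO_scale unfolding vmo_eq_def by blast
qed

lemma vmo_eq_refl: "f \<in> VMO \<Longrightarrow> vmo_eq f f"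
  by (auto simp: vmo_eq_def intro!: exI[of _ 0])


section \<open>VMO modulo constants as a normed space\<close>

text \<open>Only the real structure is instantiated, since extreme points depend on nothing else.\<close>

quotient_type vmo = "complex \<Rightarrow> complex" / partial: vmo_eq
  by (rule part_equivp_vmo_eq)

instantiation vmo :: real_normed_vector
begin

lift_definition zero_vmo :: vmo is "\<lambda>_. 0"
  by (rule vmo_eq_refl[OF VMO_const])

lift_definition plus_vmo :: "vmo \<Rightarrow> vmo \<Rightarrow> vmo" is "\<lambda>f g \<zeta>. f \<zeta> + g \<zeta>"
  by (rule vmo_eq_add)

lift_definition uminus_vmo :: "vmo \<Rightarrow> vmo" is "\<lambda>f \<zeta>. - f \<zeta>"
  using vmo_eq_scale[of _ _ "-1"] by simp

lift_definition minus_vmo :: "vmo \<Rightarrow> vmo \<Rightarrow> vmo" is "\<lambda>f g \<zeta>. f \<zeta> - g \<zeta>"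
  using vmo_eq_add vmo_eq_scale[of _ _ "-1"] by fastforce

lift_definition scaleR_vmo :: "real \<Rightarrow> vmo \<Rightarrow> vmo" is "\<lambda>a f \<zeta>. a *\<^sub>R f \<zeta>"
  unfolding scaleR_conv_of_real by (rule vmo_eq_scale)

lift_definition norm_vmo :: "vmo \<Rightarrow> real" is garsia_norm
  by (rule garsia_norm_cong)

definition dist_vmo :: "vmo \<Rightarrow> vmo \<Rightarrow> real" where
  "dist_vmo x y = norm (x - y)"

definition sgn_vmo :: "vmo \<Rightarrow> vmo" where
  "sgn_vmo x = inverse (norm x) *\<^sub>R x"

definition uniformity_vmo :: "(vmo \<times> vmo) filter" where
  "uniformity_vmo = (INF e\<in>{0<..}. principal {(x, y). dist x y < e})"

definition open_vmo :: "vmo set \<Rightarrow> bool" where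
  "open_vmo U \<longleftrightarrow> (\<forall>x\<in>U. eventually (\<lambda>(x', y). x' = x \<longrightarrow> y \<in> U) uniformity)"

instance
proof
  have eqI: "vmo_eq f g" if "f \<in> VMO" "f = g" for f g
    using that vmo_eq_refl by simp
  have V: "f \<in> VMO" if "vmo_eq f f" for f using that by (simp add: vmo_eq_def)
  fix x y z :: vmo and a b :: real
  show "x + y + z = x + (y + z)"
    by transfer (auto intro!: eqI VMO_add dest!: V)
  show "x + y = y + x"
    by transfer (auto intro!: eqI VMO_add dest!: V)
  show "0 + x = x"
    by transfer (auto intro!: eqI dest!: V)
  show "- x + x = 0"
    by transfer (auto intro!: eqI VMO_const)
  show "x - y = x + - y"
    by transfer (use VMO_add VMO_scale[of _ "-1"] in \<open>force intro!: eqI dest!: V\<close>)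
  show "a *\<^sub>R (x + y) = a *\<^sub>R x + a *\<^sub>R y"
    by transfer (auto intro!: eqI VMO_scale VMO_add dest!: V simp: scaleR_conv_of_real distrib_left)
  show "(a + b) *\<^sub>R x = a *\<^sub>R x + b *\<^sub>R x"
    by transfer (use VMO_scale[of _ "of_real _ + of_real _"] in
        \<open>auto intro!: eqI dest!: V simp: scaleR_conv_of_real distrib_right\<close>)
  show "a *\<^sub>R b *\<^sub>R x = (a * b) *\<^sub>R x"
    by transfer (auto intro!: eqI VMO_scale dest!: V simp: scaleR_conv_of_real)
  show "1 *\<^sub>R x = x"
    by transfer (auto intro!: eqI dest!: V)
  show "norm x = 0 \<longleftrightarrow> x = 0"
    by transfer (rule garsia_norm_eq_0_iff, rule V)
  show "norm (x + y) \<le> norm x + norm y"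
    by transfer (auto intro!: garsia_norm_triangle VMO_imp_BMO dest!: V)
  show "norm (a *\<^sub>R x) = \<bar>a\<bar> * norm x"
    by transfer (auto dest!: V VMO_imp_BMO simp: scaleR_conv_of_real garsia_norm_scale)
qed (simp_all add: dist_vmo_def sgn_vmo_def uniformity_vmo_def open_vmo_def)

end

lemma norm_abs_vmo: "f \<in> VMO \<Longrightarrow> norm (abs_vmo f) = garsia_norm f"
  by (rule norm_vmo.abs_eq) (rule vmo_eq_refl)

lemma abs_vmo_eq_iff:
  "f \<in> VMO \<Longrightarrow> g \<in> VMO \<Longrightarrow>
    abs_vmo f = abs_vmo g \<longleftrightarrow> (\<exists>c. AE \<zeta> in circle_measure. f \<zeta> = g \<zeta> + c)"
  using Quotient3_rel[OF Quotient3_vmo, of f g] by (auto simp: vmo_eq_refl vmo_eq_def)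

lemma vmo_cases: obtains f where "f \<in> VMO" "x = abs_vmo f"
  using Quotient3_abs_rep[OF Quotient3_vmo, of x] Quotient3_rep_reflp[OF Quotient3_vmo, of x]
  by (metis vmo_eq_def)

text \<open>The library defines extreme points by open segments; for convex sets this amounts to not
  being the midpoint of two distinct points of the set.\<close>

lemma extreme_point_of_iff_midpoint:
  fixes S :: "'a::real_vector set"
  assumes S: "convex S"
  shows "x extreme_point_of S \<longleftrightarrow>
    x \<in> S \<and> \<not> (\<exists>u\<in>S. \<exists>v\<in>S. u \<noteq> v \<and> x = (1 / 2) *\<^sub>R (u + v))"
proof -
  have *: "\<exists>u\<in>S. \<exists>v\<in>S. u \<noteq> v \<and> x = (1 / 2) *\<^sub>R (u + v)"
    if a: "a \<in> S" and b: "b \<in> S" and x: "x \<in> open_segment a b" for a b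
  proof -
    from x obtain t where t: "0 < t" "t < 1" "a \<noteq> b" and xt: "x = (1 - t) *\<^sub>R a + t *\<^sub>R b"
      by (auto simp: in_segment)
    define s where "s = min t (1 - t)"
    have s: "0 < s" "s \<le> t" "s \<le> 1 - t" using t by (auto simp: s_def)
    define u v where "u = x - s *\<^sub>R (b - a)" and "v = x + s *\<^sub>R (b - a)"
    have "u = (1 - (t - s)) *\<^sub>R a + (t - s) *\<^sub>R b" "v = (1 - (t + s)) *\<^sub>R a + (t + s) *\<^sub>R b"
      by (simp_all add: u_def v_def xt scaleR_left_distrib scaleR_left_diff_distrib
          scaleR_right_diff_distrib)
    then have "u \<in> S" "v \<in> S"
      using s t by (auto intro!: convexD[OF S a b])
    moreover have "v - u = (2 * s) *\<^sub>R (b - a)"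
      by (simp add: u_def v_def scaleR_2 flip: scaleR_scaleR)
    then have "u \<noteq> v" using s t by auto
    moreover have "u + v = 2 *\<^sub>R x"
      by (simp add: u_def v_def scaleR_2)
    then have "x = (1 / 2) *\<^sub>R (u + v)" by simp
    ultimately show ?thesis by blast
  qed
  have "(1 / 2) *\<^sub>R (u + v) \<in> open_segment u v" if "u \<noteq> v" for u v :: 'a
    using that by (auto simp: in_segment scaleR_right_distrib intro!: exI[of _ "1 / 2"])
  with * show ?thesis
    unfolding extreme_point_of_def by blast
qed

end

theory Submission
  imports Defs
begin

text \<open>
  For a fixed point \<open>z\<close> of the disc, \<open>Phi f z\<close> is the variance of \<open>f\<close> with respect to the
  probability measure on the circle with density \<open>poisson_kernel z\<close>. It is therefore a quadratic
  form in \<open>f\<close>: it satisfies the parallelogram law (lemma \<open>Phi_parallelogram\<close>), and, since the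
  Poisson kernel is positive, it vanishes only on constants. So each single seminorm
  \<open>f \<mapsto> sqrt (Phi f z)\<close> is a Hilbert space norm on functions modulo constants, and is strictly
  convex.

  A supremum of strictly convex norms need not be strictly convex, but it is so at a function for
  which the supremum is attained. On \<open>VMO\<close> it always is (lemma \<open>garsia_norm_attained\<close>):
  \<open>Phi f\<close> is continuous in the disc and tends to \<open>0\<close> at the boundary. Hence if \<open>f\<close> has norm \<open>1\<close>
  and is the midpoint of \<open>u\<close> and \<open>v\<close> in the unit ball, then at a point \<open>z\<close> with \<open>Phi f z = 1\<close> the
  parallelogram law leaves \<open>Phi (u - v) z \<le> 0\<close>, so \<open>u - v\<close> is constant.

  Conversely, a point of norm less than \<open>1\<close> is the midpoint of a short segment inside the ball,
  provided that the space is not trivial. The identity function on the circle is an element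
  of \<open>VMO\<close> that is not constant.
\<close>

section \<open>The parallelogram law\<close>

lemma L2_circle_diff:
  assumes "f \<in> L2_circle" "g \<in> L2_circle"
  shows "(\<lambda>\<zeta>. f \<zeta> - g \<zeta>) \<in> L2_circle"
  using L2_circle_add[OF assms(1) L2_circle_scale[OF assms(2), of "-1"]] by simp

lemma parallelogram_law:
  fixes x y :: "'a::real_inner"
  shows "(norm (x + y))\<^sup>2 + (norm (x - y))\<^sup>2 = 2 * (norm x)\<^sup>2 + 2 * (norm y)\<^sup>2"
  by (simp add: power2_norm_eq_inner inner_simps inner_commute)

text \<open>Both terms of \<open>Phi\<close> obey the law, one by integrating it pointwise, the other because the
  Poisson integral is additive.\<close>

lemma Phi_parallelogram:
  assumes z: "norm z < 1" and f: "f \<in> L2_circle" and g: "g \<in> L2_circle"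
  shows "Phi (\<lambda>\<zeta>. f \<zeta> + g \<zeta>) z + Phi (\<lambda>\<zeta>. f \<zeta> - g \<zeta>) z = 2 * Phi f z + 2 * Phi g z"
proof -
  let ?sq = "\<lambda>h. poisson_integral (\<lambda>\<zeta>. (norm (h \<zeta> :: complex))\<^sup>2) z"
  note int = L2_circle_integrable and sq = L2_circle_integrable_square
  have "?sq (\<lambda>\<zeta>. f \<zeta> + g \<zeta>) + ?sq (\<lambda>\<zeta>. f \<zeta> - g \<zeta>)
      = poisson_integral (\<lambda>\<zeta>. (norm (f \<zeta> + g \<zeta>))\<^sup>2 + (norm (f \<zeta> - g \<zeta>))\<^sup>2) z"
    by (rule poisson_integral_add[symmetric, OF z sq[OF L2_circle_add[OF f g]]
          sq[OF L2_circle_diff[OF f g]]])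
  also have "\<dots> = poisson_integral (\<lambda>\<zeta>. 2 *\<^sub>R (norm (f \<zeta>))\<^sup>2 + 2 *\<^sub>R (norm (g \<zeta>))\<^sup>2) z"
    by (simp add: parallelogram_law)
  also have "\<dots> = 2 *\<^sub>R ?sq f + 2 *\<^sub>R ?sq g"
    using sq[OF f] sq[OF g]
    by (simp only: poisson_integral_add[OF z] poisson_integral_scaleR[OF z]
        integrable_scaleR_right)
  finally have squares: "?sq (\<lambda>\<zeta>. f \<zeta> + g \<zeta>) + ?sq (\<lambda>\<zeta>. f \<zeta> - g \<zeta>) = 2 * ?sq f + 2 * ?sq g"
    by simp
  have plus: "poisson_integral (\<lambda>\<zeta>. f \<zeta> + g \<zeta>) z = poisson_integral f z + poisson_integral g z"
    by (rule poisson_integral_add[OF z int[OF f] int[OF g]])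
  have "poisson_integral f z
      = poisson_integral (\<lambda>\<zeta>. f \<zeta> - g \<zeta>) z + poisson_integral g z"
    using poisson_integral_add[OF z int[OF L2_circle_diff[OF f g]] int[OF g]] by simp
  then have minus: "poisson_integral (\<lambda>\<zeta>. f \<zeta> - g \<zeta>) z
      = poisson_integral f z - poisson_integral g z"
    by simp
  show ?thesis
    using squares parallelogram_law[of "poisson_integral f z" "poisson_integral g z"]
    by (simp add: Phi_def plus minus)
qed

section \<open>The Garsia norm of a VMO function is attained\<close>

lemma poisson_kernel_le:
  assumes z: "norm z \<le> r" and r: "r < 1" and \<zeta>: "norm \<zeta> = 1"
  shows "poisson_kernel z \<zeta> \<le> 1 / (1 - r)\<^sup>2"
  unfolding poisson_kernel_def
proof (rule frac_le)
  have "1 - r \<le> norm (\<zeta> - z)"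
    using norm_triangle_ineq2[of \<zeta> z] z \<zeta> by simp
  then show "(1 - r)\<^sup>2 \<le> (norm (\<zeta> - z))\<^sup>2"
    using r by (intro power_mono) auto
qed (use r in auto)

text \<open>Near a point of the disc the Poisson kernel is bounded uniformly in both variables, so
  dominated convergence applies.\<close>

lemma continuous_on_poisson_integral:
  fixes f :: "complex \<Rightarrow> 'a::{banach, second_countable_topology}"
  assumes f: "integrable circle_measure f"
  shows "continuous_on (ball 0 1) (poisson_integral f)"
  unfolding continuous_on_sequentially
proof (intro allI ballI impI)
  fix X :: "nat \<Rightarrow> complex" and a
  assume "a \<in> ball 0 1" and X: "(\<forall>n. X n \<in> ball 0 1) \<and> X \<longlonglongrightarrow> a"
  then have a: "norm a < 1" and X1: "norm (X n) < 1" and Xa: "X \<longlonglongrightarrow> a" for n by auto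
  obtain r where r: "norm a < r" "r < 1" using dense[OF a] by blast
  have "eventually (\<lambda>n. norm (X n) < r) sequentially"
    by (rule order_tendstoD(2)[OF tendsto_norm[OF Xa] r(1)])
  then obtain N where N: "norm (X n) < r" if "n \<ge> N" for n
    by (auto simp: eventually_sequentially)
  have [measurable]: "poisson_kernel z \<in> borel_measurable circle_measure" if "norm z < 1" for z
    by (rule continuous_on_circle_measurable[OF continuous_poisson_kernel[OF that]])
  note [measurable] = borel_measurable_integrable[OF f]
  have "(\<lambda>n. poisson_integral f (X (n + N))) \<longlonglongrightarrow> poisson_integral f a"
    unfolding poisson_integral_def
  proof (rule integral_dominated_convergence[where w = "\<lambda>\<zeta>. 1 / (1 - r)\<^sup>2 * norm (f \<zeta>)"])
    show "integrable circle_measure (\<lambda>\<zeta>. 1 / (1 - r)\<^sup>2 * norm (f \<zeta>))"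
      using f by simp
    show "AE \<zeta> in circle_measure. (\<lambda>n. poisson_kernel (X (n + N)) \<zeta> *\<^sub>R f \<zeta>)
        \<longlonglongrightarrow> poisson_kernel a \<zeta> *\<^sub>R f \<zeta>"
    proof (rule AE_I2)
      fix \<zeta> assume "\<zeta> \<in> space circle_measure"
      then have "\<zeta> \<noteq> a" using a by auto
      then show "(\<lambda>n. poisson_kernel (X (n + N)) \<zeta> *\<^sub>R f \<zeta>) \<longlonglongrightarrow> poisson_kernel a \<zeta> *\<^sub>R f \<zeta>"
        unfolding poisson_kernel_def
        by (intro tendsto_intros LIMSEQ_ignore_initial_segment[OF Xa]) auto
    qed
    show "AE \<zeta> in circle_measure.
        norm (poisson_kernel (X (n + N)) \<zeta> *\<^sub>R f \<zeta>) \<le> 1 / (1 - r)\<^sup>2 * norm (f \<zeta>)" for n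
    proof (rule AE_I2)
      fix \<zeta> assume "\<zeta> \<in> space circle_measure"
      then have "\<bar>poisson_kernel (X (n + N)) \<zeta>\<bar> \<le> 1 / (1 - r)\<^sup>2"
        using poisson_kernel_le[of "X (n + N)" r \<zeta>] poisson_kernel_nonneg[OF X1] r N[of "n + N"]
        by simp
      then show "norm (poisson_kernel (X (n + N)) \<zeta> *\<^sub>R f \<zeta>) \<le> 1 / (1 - r)\<^sup>2 * norm (f \<zeta>)"
        unfolding norm_scaleR by (rule mult_right_mono) simp
    qed
  qed (use a X1 in measurable)
  then show "(poisson_integral f \<circ> X) \<longlonglongrightarrow> poisson_integral f a"
    unfolding comp_def by (rule LIMSEQ_offset)
qed

lemma continuous_on_Phi:
  assumes "f \<in> L2_circle"
  shows "continuous_on (ball 0 1) (Phi f)"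
  unfolding Phi_def[abs_def]
  by (intro continuous_intros continuous_on_poisson_integral L2_circle_integrable_square
      L2_circle_integrable assms)

text \<open>Outside a compact disc \<open>sqrt (Phi f z)\<close> is at most half of the norm, so the supremum is the
  maximum over that compact disc.\<close>

lemma garsia_norm_attained:
  assumes f: "f \<in> VMO" and pos: "0 < garsia_norm f"
  obtains z where "norm z < 1" "sqrt (Phi f z) = garsia_norm f"
proof -
  define M where "M = garsia_norm f"
  have "(Phi f \<longlongrightarrow> 0) (filtercomap norm (at_left 1))"
    using f by (simp add: VMO_def)
  then have "eventually (\<lambda>z. Phi f z < (M / 2)\<^sup>2) (filtercomap norm (at_left 1))"
    by (rule order_tendstoD) (use pos in \<open>simp add: M_def\<close>)
  then obtain Q where "eventually Q (at_left (1::real))"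
      and Q: "\<And>z. Q (norm z) \<Longrightarrow> Phi f z < (M / 2)\<^sup>2"
    by (auto simp: eventually_filtercomap)
  then obtain b where b: "b < 1" "\<And>y. b < y \<Longrightarrow> y < 1 \<Longrightarrow> Q y"
    by (auto simp: eventually_at_left_field)
  define r where "r = max 0 b"
  have r: "0 \<le> r" "r < 1" using b by (auto simp: r_def)
  have small: "sqrt (Phi f z) \<le> M / 2" if "r < norm z" "norm z < 1" for z
  proof (rule real_le_lsqrt)
    show "Phi f z \<le> (M / 2)\<^sup>2"
      using Q[OF b(2)[of "norm z"]] that by (simp add: r_def)
  qed (use pos in \<open>simp add: M_def\<close>)
  have "continuous_on (cball 0 r) (\<lambda>z. sqrt (Phi f z))"
    by (intro continuous_intros continuous_on_subset[OF continuous_on_Phi[OF VMO_imp_L2[OF f]]])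
      (use r in auto)
  then obtain z where z: "z \<in> cball 0 r"
      and max: "\<And>w. w \<in> cball 0 r \<Longrightarrow> sqrt (Phi f w) \<le> sqrt (Phi f z)"
    using continuous_attains_sup[of "cball 0 r" "\<lambda>z. sqrt (Phi f z)"] r by auto
  have z1: "norm z < 1" using z r by simp
  have "sqrt (Phi f w) \<le> max (sqrt (Phi f z)) (M / 2)" if "norm w < 1" for w
  proof (cases "norm w \<le> r")
    case True
    then show ?thesis using max[of w] by (intro max.coboundedI1) simp
  next
    case False
    then show ?thesis using small[of w] that by (intro max.coboundedI2) simp
  qed
  then have "garsia_norm f \<le> max (sqrt (Phi f z)) (M / 2)"
    unfolding garsia_norm_def by (intro cSUP_least) auto
  then have "M \<le> sqrt (Phi f z)" using pos by (auto simp: M_def max_def split: if_splits)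
  then show thesis
    using that[OF z1] garsia_norm_upper[OF VMO_imp_BMO[OF f] z1] by (simp add: M_def)
qed

section \<open>A VMO function that is not constant\<close>

lemma id_in_L2_circle: "(\<lambda>\<zeta>. \<zeta>) \<in> L2_circle"
  by (auto simp: L2_circle_def
      intro!: continuous_on_circle_measurable integrable_bounded_circle continuous_intros)

text \<open>The square of the distance from \<open>\<zeta>\<close> to \<open>z\<close> cancels the denominator of the Poisson kernel,
  so the mean square deviation of the identity from the value \<open>z\<close> is computed at once.\<close>

lemma Phi_id_le:
  assumes z: "norm z < 1"
  shows "Phi (\<lambda>\<zeta>. \<zeta>) z \<le> (1 - (norm z)\<^sup>2) * measure circle_measure (sphere 0 1)"
proof -
  have "Phi (\<lambda>\<zeta>. \<zeta>) z \<le> poisson_integral (\<lambda>\<zeta>. (norm (\<zeta> - z))\<^sup>2) z"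
    using poisson_integral_square_shift[OF z id_in_L2_circle, of z] by simp
  also have "\<dots> = (LINT \<zeta>|circle_measure. 1 - (norm z)\<^sup>2)"
    unfolding poisson_integral_def
    by (rule Bochner_Integration.integral_cong) (use z in \<open>auto simp: poisson_kernel_def\<close>)
  finally show ?thesis by (simp add: mult.commute)
qed

lemma id_in_VMO: "(\<lambda>\<zeta>. \<zeta>) \<in> VMO"
proof -
  let ?F = "filtercomap norm (at_left (1::real)) :: complex filter"
  let ?m = "measure circle_measure (sphere 0 1)"
  have "sqrt (Phi (\<lambda>\<zeta>. \<zeta>) z) \<le> sqrt ?m" if "norm z < 1" for z
    using Phi_id_le[OF that] mult_right_mono[of "1 - (norm z)\<^sup>2" 1 ?m] by simp
  then have BMO: "(\<lambda>\<zeta>. \<zeta>) \<in> BMO"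
    using id_in_L2_circle by (auto simp: BMO_def intro!: bdd_aboveI2[of _ _ "sqrt ?m"])
  have "filterlim norm (at_left 1) ?F"
    by (rule filterlim_filtercomap)
  then have "(norm \<longlongrightarrow> 1) ?F"
    by (rule filterlim_mono) (auto simp: at_within_def)
  then have "((\<lambda>z. (1 - (norm z)\<^sup>2) * ?m) \<longlongrightarrow> (1 - 1\<^sup>2) * ?m) ?F"
    by (intro tendsto_intros)
  then have "((\<lambda>z. (1 - (norm z)\<^sup>2) * ?m) \<longlongrightarrow> 0) ?F" by simp
  then have "(Phi (\<lambda>\<zeta>. \<zeta>) \<longlongrightarrow> 0) ?F"
    by (rule tendsto_sandwich[rotated 3, where f = "\<lambda>_. 0"])
      (auto intro!: eventually_mono[OF eventually_in_disc] Phi_nonneg Phi_id_le id_in_L2_circle)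
  with BMO show ?thesis by (simp add: VMO_def)
qed

text \<open>At the centre of the disc the identity has mean \<open>0\<close> and mean square \<open>1\<close>.\<close>

lemma Phi_id_0: "Phi (\<lambda>\<zeta>. \<zeta>) 0 = 1"
proof -
  have "poisson_integral (\<lambda>\<zeta>. \<zeta>) 0 = (LINT \<zeta>|circle_measure. \<zeta>)"
    unfolding poisson_integral_def
    by (rule Bochner_Integration.integral_cong) (auto simp: poisson_kernel_def)
  then have "poisson_integral (\<lambda>\<zeta>. \<zeta>) 0 = (0::complex)"
    using circle_mean_value[of "\<lambda>\<zeta>. \<zeta>"] by simp
  moreover have "poisson_integral (\<lambda>\<zeta>::complex. (norm \<zeta>)\<^sup>2) 0 = poisson_integral (\<lambda>_. 1) 0"
    unfolding poisson_integral_def by (rule Bochner_Integration.integral_cong) auto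
  ultimately show ?thesis
    by (simp add: Phi_def poisson_integral_const)
qed

lemma ex_nonzero_vmo: "\<exists>x :: vmo. x \<noteq> 0"
proof
  have "sqrt (Phi (\<lambda>\<zeta>. \<zeta>) 0) \<le> norm (abs_vmo (\<lambda>\<zeta>. \<zeta>))"
    using garsia_norm_upper[OF VMO_imp_BMO[OF id_in_VMO], of 0] norm_abs_vmo[OF id_in_VMO] by simp
  then show "abs_vmo (\<lambda>\<zeta>. \<zeta>) \<noteq> 0"
    by (auto simp: Phi_id_0)
qed

section \<open>Extreme points of the unit ball\<close>

lemma extreme_point_of_cball_imp_norm_eq_1:
  fixes x :: "'a::real_normed_vector"
  assumes ex: "\<exists>y::'a. y \<noteq> 0" and x: "x extreme_point_of cball 0 1"
  shows "norm x = 1"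
proof (rule ccontr)
  assume "norm x \<noteq> 1"
  moreover have "norm x \<le> 1" using x by (simp add: extreme_point_of_def)
  ultimately have lt: "norm x < 1" by simp
  obtain y :: 'a where y: "y \<noteq> 0" using ex by blast
  \<comment> \<open>The length of \<open>e\<close> is the distance from \<open>x\<close> to the sphere, so \<open>x \<plusminus> e\<close> stay in the ball.\<close>
  define e where "e = ((1 - norm x) / norm y) *\<^sub>R y"
  have e: "norm e = 1 - norm x" "e \<noteq> 0" using lt y by (auto simp: e_def)
  have "x + e \<in> cball 0 1" "x - e \<in> cball 0 1"
    using norm_triangle_ineq[of x e] norm_triangle_ineq4[of x e] e by auto
  moreover have "x + e \<noteq> x - e"
  proof
    assume "x + e = x - e"
    then have "2 *\<^sub>R e = 0" by (simp add: scaleR_2 algebra_simps)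
    with e show False by simp
  qed
  moreover have "x = (1 / 2) *\<^sub>R ((x + e) + (x - e))"
    by (simp flip: scaleR_2)
  ultimately show False
    using x unfolding extreme_point_of_iff_midpoint[OF convex_cball] by blast
qed

text \<open>At a point where the norm of the sum is attained, the two summands already use up the
  right-hand side of the parallelogram law, and nothing is left for their difference. This one
  point of the disc suffices to make the difference constant.\<close>

lemma vmo_strictly_convex:
  fixes u v :: vmo
  assumes u: "norm u \<le> 1" and v: "norm v \<le> 1" and mid: "norm ((1 / 2) *\<^sub>R (u + v)) = 1"
  shows "u = v"
proof -
  obtain f where f: "f \<in> VMO" and uf: "u = abs_vmo f" by (rule vmo_cases)
  obtain g where g: "g \<in> VMO" and vg: "v = abs_vmo g" by (rule vmo_cases)
  define s where "s = (\<lambda>\<zeta>. f \<zeta> + g \<zeta>)"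
  have s: "s \<in> VMO" unfolding s_def by (rule VMO_add[OF f g])
  have "u + v = abs_vmo s"
    unfolding uf vg s_def by (rule plus_vmo.abs_eq) (auto intro: vmo_eq_refl f g)
  then have norm_s: "garsia_norm s = 2"
    using mid norm_abs_vmo[OF s] by simp
  then obtain z where z: "norm z < 1" and "sqrt (Phi s z) = 2"
    using garsia_norm_attained[OF s] by auto
  then have Phi_s: "Phi s z = 4"
    using real_sqrt_pow2[OF Phi_nonneg[OF z VMO_imp_L2[OF s]]] by simp
  have "garsia_norm f \<le> 1" "garsia_norm g \<le> 1"
    using u v norm_abs_vmo[OF f] norm_abs_vmo[OF g] by (simp_all add: uf vg)
  then have "sqrt (Phi f z) \<le> 1" "sqrt (Phi g z) \<le> 1"
    using garsia_norm_upper[OF VMO_imp_BMO[OF f] z] garsia_norm_upper[OF VMO_imp_BMO[OF g] z]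
    by linarith+
  then have "Phi f z \<le> 1" "Phi g z \<le> 1" by simp_all
  then have "Phi (\<lambda>\<zeta>. f \<zeta> - g \<zeta>) z \<le> 0"
    using Phi_parallelogram[OF z VMO_imp_L2[OF f] VMO_imp_L2[OF g]] Phi_s by (simp add: s_def)
  moreover have diff: "(\<lambda>\<zeta>. f \<zeta> - g \<zeta>) \<in> L2_circle"
    by (intro L2_circle_diff VMO_imp_L2 f g)
  ultimately have "Phi (\<lambda>\<zeta>. f \<zeta> - g \<zeta>) z = 0"
    using Phi_nonneg[OF z diff] by simp
  from Phi_eq_0_imp_AE_const[OF z diff this]
  obtain c where "AE \<zeta> in circle_measure. f \<zeta> - g \<zeta> = c" by blast
  then have "AE \<zeta> in circle_measure. f \<zeta> = g \<zeta> + c"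
    by eventually_elim (simp add: algebra_simps)
  then show ?thesis
    unfolding uf vg abs_vmo_eq_iff[OF f g] by blast
qed

theorem corollary2p8:
  shows "{f :: vmo. f extreme_point_of cball 0 1} = {f :: vmo. norm f = 1}"
proof (intro equalityI subsetI CollectI; unfold mem_Collect_eq)
  fix f :: vmo assume "f extreme_point_of cball 0 1"
  then show "norm f = 1"
    by (rule extreme_point_of_cball_imp_norm_eq_1[OF ex_nonzero_vmo])
next
  fix f :: vmo assume "norm f = 1"
  then show "f extreme_point_of cball 0 1"
    unfolding extreme_point_of_iff_midpoint[OF convex_cball]
    using vmo_strictly_convex by auto
qed

end
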